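(* Let $\mathcal{G}$ be a security game and suppose that $\langle \mathbf{C}, \mathbf{a}\rangle$ and $\langle \mathbf{C}', \mathbf{a}'\rangle$ are two Nash equilibrium profiles of $\mathcal{G}$. Then $\langle \mathbf{C}, \mathbf{a}'\rangle$ and $\langle \mathbf{C}', \mathbf{a}\rangle$ are also Nash equilibrium profiles of $\mathcal{G}$.
   Context: A security game is a two-player game between a defender and an attacker, given by: a finite nonempty set of targets $T=\{t_1,\dots,t_n\}$; defender resources $r_1,\dots,r_K$; for each resource $r_i$ a nonempty set $S_i$ of schedules that $r_i$ can cover, each schedule being a subset of $T$; and for each target $t$ real payoffs $U_d^c(t),U_d^u(t)$ (defender, $t$ attacked while covered/uncovered) and $U_a^c(t),U_a^u(t)$ (attacker), such that $\Delta U_d(t):=U_d^c(t)-U_d^u(t)>0$ and $\Delta U_a(t):=U_a^u(t)-U_a^c(t)>0$. A defender pure strategy is an assignment $(s_1,\dots,s_K)\in\prod_{i=1}^K S_i$, represented by its coverage vector $\mathbf{d}\in\{0,1\}^n$ with $d_j=1$ iff $t_j\in\bigcup_i s_i$. Let $\mathcal{D}\subseteq\{0,1\}^n$ be the set of coverage vectors arising in this way. A defender (mixed) strategy $\mathbf{C}=(C_{\mathbf{d}})_{\mathbf{d}\in\mathcal{D}}$ is a probability distribution on $\mathcal{D}$; its vector of marginal coverage probabilities is $\mathbf{c}=\varphi(\mathbf{C})$, $c_i=\sum_{\mathbf{d}\in\mathcal{D}} d_iC_{\mathbf{d}}$. An attacker (mixed) strategy $\mathbf{a}=(a_i)$ is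 a probability distribution on $T$. Utilities are $$U_d(\mathbf{C},\mathbf{a})=\sum_{i=1}^n a_i\big(c_iU_d^c(t_i)+(1-c_i)U_d^u(t_i)\big),\qquad U_a(\mathbf{C},\mathbf{a})=\sum_{i=1}^n a_i\big(c_iU_a^c(t_i)+(1-c_i)U_a^u(t_i)\big).$$ A profile $\langle\mathbf{C},\mathbf{a}\rangle$ is a Nash equilibrium (NE) if $U_d(\mathbf{C},\mathbf{a})\ge U_d(\mathbf{C}',\mathbf{a})$ for all defender strategies $\mathbf{C}'$ and $U_a(\mathbf{C},\mathbf{a})\ge U_a(\mathbf{C},\mathbf{a}')$ for all attacker strategies $\mathbf{a}'$. *)

theory Defs
  imports "HOL-Probability.Probability"
begin

text \<open>
  Targets form an explicit finite carrier inside the type \<open>'t\<close>. The resources are indexed by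
  \<open>{1..num_resources G}\<close>; the values of \<open>schedules G\<close> at other indices, and of the
  payoff functions outside \<open>targets G\<close>, are never used.
\<close>

record 't game =
  targets :: "'t set"
  num_resources :: nat
  schedules :: "nat \<Rightarrow> 't set set"
  def_covered :: "'t \<Rightarrow> real"
  def_uncovered :: "'t \<Rightarrow> real"
  att_covered :: "'t \<Rightarrow> real"
  att_uncovered :: "'t \<Rightarrow> real"

definition security_game :: "'t game \<Rightarrow> bool" where
  "security_game G \<longleftrightarrow>
     finite (targets G) \<and> targets G \<noteq> {} \<and>
     (\<forall>i\<in>{1..num_resources G}. schedules G i \<noteq> {} \<and> (\<forall>s\<in>schedules G i. s \<subseteq> targets G)) \<and>
     (\<forall>t\<in>targets G. def_covered G t - def_uncovered G t > 0) \<and>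
     (\<forall>t\<in>targets G. att_uncovered G t - att_covered G t > 0)"

text \<open>
  A coverage vector is a 0/1-valued function. Schedules of a security game are subsets of
  \<open>targets G\<close>, so it vanishes outside \<open>targets G\<close>, and distinct elements of
  \<open>coverage_vectors G\<close> differ on \<open>targets G\<close>.
\<close>

definition coverage_vector :: "'t game \<Rightarrow> (nat \<Rightarrow> 't set) \<Rightarrow> 't \<Rightarrow> real" where
  "coverage_vector G s = (\<lambda>t. if t \<in> (\<Union>i\<in>{1..num_resources G}. s i) then 1 else 0)"

definition coverage_vectors :: "'t game \<Rightarrow> ('t \<Rightarrow> real) set" where
  "coverage_vectors G = coverage_vector G ` (Pi\<^sub>E {1..num_resources G} (schedules G))"

definition defender_strategy :: "'t game \<Rightarrow> ('t \<Rightarrow> real) pmf \<Rightarrow> bool" where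
  "defender_strategy G C \<longleftrightarrow> set_pmf C \<subseteq> coverage_vectors G"

definition attacker_strategy :: "'t game \<Rightarrow> 't pmf \<Rightarrow> bool" where
  "attacker_strategy G a \<longleftrightarrow> set_pmf a \<subseteq> targets G"

definition marginal_coverage :: "'t game \<Rightarrow> ('t \<Rightarrow> real) pmf \<Rightarrow> 't \<Rightarrow> real" where
  "marginal_coverage G C t = (\<Sum>d\<in>coverage_vectors G. d t * pmf C d)"

definition defender_utility :: "'t game \<Rightarrow> ('t \<Rightarrow> real) pmf \<Rightarrow> 't pmf \<Rightarrow> real" where
  "defender_utility G C a =
     (\<Sum>t\<in>targets G. pmf a t * (marginal_coverage G C t * def_covered G t
        + (1 - marginal_coverage G C t) * def_uncovered G t))"

definition attacker_utility :: "'t game \<Rightarrow> ('t \<Rightarrow> real) pmf \<Rightarrow> 't pmf \<Rightarrow> real" where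
  "attacker_utility G C a =
     (\<Sum>t\<in>targets G. pmf a t * (marginal_coverage G C t * att_covered G t
        + (1 - marginal_coverage G C t) * att_uncovered G t))"

definition nash_equilibrium :: "'t game \<Rightarrow> ('t \<Rightarrow> real) pmf \<Rightarrow> 't pmf \<Rightarrow> bool" where
  "nash_equilibrium G C a \<longleftrightarrow>
     defender_strategy G C \<and> attacker_strategy G a \<and>
     (\<forall>C'. defender_strategy G C' \<longrightarrow> defender_utility G C a \<ge> defender_utility G C' a) \<and>
     (\<forall>a'. attacker_strategy G a' \<longrightarrow> attacker_utility G C a \<ge> attacker_utility G C a')"

end

theory Submission
  imports Defs
begin

text \<open>
  Reweight an attacker strategy \<open>a\<close> to \<open>w t = a t * \<Delta>U\<^sub>d t / \<Delta>U\<^sub>a t\<close>. Up to a term depending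
  on \<open>a\<close> only, the defender's utility is then minus the \<open>w\<close>-weighted sum of the attacker's payoffs,
  while \<open>w\<close> and \<open>a\<close> have the same support. So the game behaves like a zero-sum game: with
  \<open>M\<close>, \<open>M'\<close> the attacker's utilities in the two equilibria and \<open>v\<close>, \<open>v'\<close> the attacker's payoffs
  against \<open>C\<close>, \<open>C'\<close>, we get \<open>M * \<Sum>w = \<Sum>w v \<le> \<Sum>w v' \<le> M' * \<Sum>w\<close>. By symmetry \<open>M = M'\<close>, so these
  are equalities: \<open>C'\<close> is as good as \<open>C\<close> against \<open>a\<close>, and \<open>v' = M'\<close> on the support of \<open>a\<close>.
\<close>

definition attacker_payoff :: "'t game \<Rightarrow> ('t \<Rightarrow> real) pmf \<Rightarrow> 't \<Rightarrow> real" where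
  "attacker_payoff G C t =
     marginal_coverage G C t * att_covered G t + (1 - marginal_coverage G C t) * att_uncovered G t"

definition zero_sum_weight :: "'t game \<Rightarrow> 't pmf \<Rightarrow> 't \<Rightarrow> real" where
  "zero_sum_weight G a t =
     pmf a t * ((def_covered G t - def_uncovered G t) / (att_uncovered G t - att_covered G t))"

lemma attacker_utility_eq_sum_payoff:
  "attacker_utility G C a = (\<Sum>t\<in>targets G. pmf a t * attacker_payoff G C t)"
  by (simp add: attacker_utility_def attacker_payoff_def)

lemma sum_pmf_targets:
  assumes "security_game G" "attacker_strategy G a"
  shows "(\<Sum>t\<in>targets G. pmf a t) = 1"
  using assms by (auto simp: security_game_def attacker_strategy_def intro: sum_pmf_eq_1)

lemma zero_sum_weight_nonneg:
  assumes "security_game G" "t \<in> targets G"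
  shows "zero_sum_weight G a t \<ge> 0"
  using assms unfolding security_game_def zero_sum_weight_def
  by (intro mult_nonneg_nonneg divide_nonneg_nonneg pmf_nonneg) (auto intro: less_imp_le)

lemma zero_sum_weight_eq_0_iff:
  assumes "security_game G" "t \<in> targets G"
  shows "zero_sum_weight G a t = 0 \<longleftrightarrow> pmf a t = 0"
  using assms by (auto simp: security_game_def zero_sum_weight_def)

text \<open>Lets the total weight be cancelled when two equilibrium values are compared.\<close>

lemma sum_zero_sum_weight_pos:
  assumes "security_game G" "attacker_strategy G a"
  shows "(\<Sum>t\<in>targets G. zero_sum_weight G a t) > 0"
proof -
  obtain t where t: "t \<in> targets G" "pmf a t \<noteq> 0"
    using sum_pmf_targets[OF assms] by (metis sum.neutral zero_neq_one)
  then have "zero_sum_weight G a t > 0"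
    using zero_sum_weight_nonneg[OF assms(1)] zero_sum_weight_eq_0_iff[OF assms(1)]
    by (metis order_le_less)
  then show ?thesis
    using assms(1) t zero_sum_weight_nonneg[OF assms(1)]
    by (intro sum_pos2[where i = t]) (auto simp: security_game_def)
qed

text \<open>Marginal coverage enters both players' payoffs affinely, with slopes of opposite sign.
  The ratio in \<open>zero_sum_weight\<close> turns one slope into the other up to sign, and the
  terms free of coverage cancel in the difference.\<close>

lemma defender_utility_diff:
  assumes "security_game G"
  shows "defender_utility G C a - defender_utility G C' a =
    (\<Sum>t\<in>targets G. zero_sum_weight G a t * (attacker_payoff G C' t - attacker_payoff G C t))"
  unfolding defender_utility_def sum_subtractf[symmetric]
proof (rule sum.cong)
  fix t assume "t \<in> targets G"
  then have nz: "att_uncovered G t - att_covered G t \<noteq> 0"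
    using assms by (auto simp: security_game_def)
  have "attacker_payoff G C' t - attacker_payoff G C t =
      (marginal_coverage G C t - marginal_coverage G C' t) * (att_uncovered G t - att_covered G t)"
    by (simp add: attacker_payoff_def algebra_simps)
  then have "zero_sum_weight G a t * (attacker_payoff G C' t - attacker_payoff G C t) =
      pmf a t * ((def_covered G t - def_uncovered G t) *
        (marginal_coverage G C t - marginal_coverage G C' t))"
    using nz by (simp add: zero_sum_weight_def)
  then show "pmf a t * (marginal_coverage G C t * def_covered G t
        + (1 - marginal_coverage G C t) * def_uncovered G t) -
      pmf a t * (marginal_coverage G C' t * def_covered G t
        + (1 - marginal_coverage G C' t) * def_uncovered G t) =
      zero_sum_weight G a t * (attacker_payoff G C' t - attacker_payoff G C t)"
    by (simp add: algebra_simps)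
qed simp

lemma attacker_utility_return_pmf:
  assumes "security_game G" "t \<in> targets G"
  shows "attacker_utility G C (return_pmf t) = attacker_payoff G C t"
proof -
  have "attacker_utility G C (return_pmf t) =
      (\<Sum>s\<in>targets G. if s = t then attacker_payoff G C s else 0)"
    unfolding attacker_utility_eq_sum_payoff by (intro sum.cong) auto
  then show ?thesis
    using assms by (simp add: security_game_def)
qed

text \<open>Attacking a single target is a deviation open to the attacker.\<close>

lemma attacker_payoff_le_utility:
  assumes "security_game G" "nash_equilibrium G C a" "t \<in> targets G"
  shows "attacker_payoff G C t \<le> attacker_utility G C a"
proof -
  have "attacker_strategy G (return_pmf t)"
    using assms by (simp add: attacker_strategy_def)
  then show ?thesis
    using assms by (metis attacker_utility_return_pmf nash_equilibrium_def)
qed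

text \<open>No target pays above the equilibrium utility, yet the average under \<open>a\<close>
  equals it, so the nonnegative gaps vanish wherever \<open>a\<close> puts mass.\<close>

lemma attacker_payoff_eq_utility:
  assumes "security_game G" "nash_equilibrium G C a" "t \<in> targets G" "pmf a t \<noteq> 0"
  shows "attacker_payoff G C t = attacker_utility G C a"
proof -
  let ?M = "attacker_utility G C a"
  have "(\<Sum>t\<in>targets G. pmf a t) = 1"
    using assms by (intro sum_pmf_targets) (auto simp: nash_equilibrium_def)
  then have "(\<Sum>t\<in>targets G. pmf a t * (?M - attacker_payoff G C t)) = 0"
    by (simp add: right_diff_distrib sum_subtractf attacker_utility_eq_sum_payoff[of G C a]
        sum_distrib_right[symmetric])
  then have "pmf a t * (?M - attacker_payoff G C t) = 0"
    using assms attacker_payoff_le_utility[OF assms(1,2)]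
    by (subst (asm) sum_nonneg_eq_0_iff) (auto simp: security_game_def)
  then show ?thesis
    using assms(4) by simp
qed

text \<open>The weight vanishes off the support of \<open>a\<close>, and on the support the payoff
  is constant.\<close>

lemma weighted_payoff_at_equilibrium:
  assumes "security_game G" "nash_equilibrium G C a"
  shows "(\<Sum>t\<in>targets G. zero_sum_weight G a t * attacker_payoff G C t) =
    attacker_utility G C a * (\<Sum>t\<in>targets G. zero_sum_weight G a t)"
  unfolding sum_distrib_left
proof (rule sum.cong)
  fix t assume "t \<in> targets G"
  then show "zero_sum_weight G a t * attacker_payoff G C t =
      attacker_utility G C a * zero_sum_weight G a t"
    using zero_sum_weight_eq_0_iff[OF assms(1)] attacker_payoff_eq_utility[OF assms]
    by (cases "pmf a t = 0") auto
qed simp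

text \<open>Read through \<open>defender_utility_diff\<close>, optimality of \<open>C\<close>
  against \<open>a\<close> says that \<open>C\<close> minimizes the weighted attacker
  payoff.\<close>

lemma weighted_payoff_le:
  assumes "security_game G" "nash_equilibrium G C a" "defender_strategy G C'"
  shows "attacker_utility G C a * (\<Sum>t\<in>targets G. zero_sum_weight G a t)
    \<le> (\<Sum>t\<in>targets G. zero_sum_weight G a t * attacker_payoff G C' t)"
proof -
  have "0 \<le> defender_utility G C a - defender_utility G C' a"
    using assms by (simp add: nash_equilibrium_def)
  then show ?thesis
    unfolding defender_utility_diff[OF assms(1)]
    by (simp add: right_diff_distrib sum_subtractf weighted_payoff_at_equilibrium[OF assms(1,2)])
qed

lemma attacker_utility_equilibrium_le:
  assumes "security_game G" "nash_equilibrium G C a" "nash_equilibrium G C' a'"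
  shows "attacker_utility G C a \<le> attacker_utility G C' a'"
proof -
  have "attacker_utility G C a * (\<Sum>t\<in>targets G. zero_sum_weight G a t)
      \<le> (\<Sum>t\<in>targets G. zero_sum_weight G a t * attacker_payoff G C' t)"
    using assms by (intro weighted_payoff_le) (auto simp: nash_equilibrium_def)
  also have "\<dots> \<le> (\<Sum>t\<in>targets G. zero_sum_weight G a t * attacker_utility G C' a')"
    using assms by (intro sum_mono mult_left_mono attacker_payoff_le_utility zero_sum_weight_nonneg)
  finally have "attacker_utility G C a * (\<Sum>t\<in>targets G. zero_sum_weight G a t)
      \<le> attacker_utility G C' a' * (\<Sum>t\<in>targets G. zero_sum_weight G a t)"
    by (simp add: sum_distrib_left mult.commute)
  then show ?thesis
    using sum_zero_sum_weight_pos[OF assms(1)] assms(2) by (simp add: nash_equilibrium_def)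
qed

lemma nash_equilibrium_exchange:
  assumes "security_game G" "nash_equilibrium G C a" "nash_equilibrium G C' a'"
  shows "nash_equilibrium G C' a"
proof -
  let ?M = "attacker_utility G C' a'" and ?w = "zero_sum_weight G a"
  \<comment> \<open>The two equilibria enter symmetrically, so the inequality holds both
    ways.\<close>
  have M: "attacker_utility G C a = ?M"
    using assms attacker_utility_equilibrium_le by (metis order_antisym)
  have C': "defender_strategy G C'" and a: "attacker_strategy G a"
    using assms by (auto simp: nash_equilibrium_def)
  have nonneg: "0 \<le> ?w t * (?M - attacker_payoff G C' t)" if "t \<in> targets G" for t
    using that zero_sum_weight_nonneg[OF assms(1)] attacker_payoff_le_utility[OF assms(1,3)]
    by simp
  have split: "(\<Sum>t\<in>targets G. ?w t * (?M - attacker_payoff G C' t)) =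
      ?M * (\<Sum>t\<in>targets G. ?w t) - (\<Sum>t\<in>targets G. ?w t * attacker_payoff G C' t)"
    by (simp add: right_diff_distrib sum_subtractf sum_distrib_left mult.commute)
  then have "(\<Sum>t\<in>targets G. ?w t * (?M - attacker_payoff G C' t)) \<le> 0"
    using weighted_payoff_le[OF assms(1,2) C'] M by simp
  then have zero: "(\<Sum>t\<in>targets G. ?w t * (?M - attacker_payoff G C' t)) = 0"
    using nonneg by (intro order_antisym sum_nonneg)
  have "defender_utility G C a - defender_utility G C' a = 0"
    unfolding defender_utility_diff[OF assms(1)]
    using zero split weighted_payoff_at_equilibrium[OF assms(1,2)] M
    by (simp add: right_diff_distrib sum_subtractf)
  \<comment> \<open>\<open>C'\<close> ties with \<open>C\<close>, which is already optimal against
    \<open>a\<close>.\<close>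
  then have defender: "defender_utility G C'' a \<le> defender_utility G C' a"
    if "defender_strategy G C''" for C''
    using that assms(2) by (simp add: nash_equilibrium_def)
  \<comment> \<open>A zero sum of nonnegative terms vanishes termwise, and zero weight means zero
    mass, so \<open>a\<close> lives on best responses to \<open>C'\<close>.\<close>
  have support: "pmf a t * attacker_payoff G C' t = pmf a t * ?M" if "t \<in> targets G" for t
  proof -
    have "?w t * (?M - attacker_payoff G C' t) = 0"
      using zero nonneg that assms(1)
      by (subst (asm) sum_nonneg_eq_0_iff) (auto simp: security_game_def)
    then show ?thesis
      using zero_sum_weight_eq_0_iff[OF assms(1) that] by (metis eq_iff_diff_eq_0 mult_eq_0_iff)
  qed
  have "attacker_utility G C' a = (\<Sum>t\<in>targets G. pmf a t * ?M)"
    unfolding attacker_utility_eq_sum_payoff[of G C' a] using support by (rule sum.cong[OF refl])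
  also have "\<dots> = ?M"
    using sum_pmf_targets[OF assms(1) a] by (metis mult_1 sum_distrib_right)
  finally have "attacker_utility G C' a = ?M" .
  \<comment> \<open>\<open>?M\<close> is the utility of \<open>a'\<close>, a best response to
    \<open>C'\<close>.\<close>
  then have "attacker_utility G C' a'' \<le> attacker_utility G C' a" if "attacker_strategy G a''" for a''
    using that assms(3) unfolding nash_equilibrium_def by metis
  then show ?thesis
    unfolding nash_equilibrium_def using C' a defender by blast
qed

theorem theorem3p5:
  fixes G :: "'t game"
    and C C' :: "('t \<Rightarrow> real) pmf"
    and a a' :: "'t pmf"
  assumes "security_game G"
    and "nash_equilibrium G C a"
    and "nash_equilibrium G C' a'"
  shows "nash_equilibrium G C a' \<and> nash_equilibrium G C' a"
  \<comment> \<open>The first instance swaps the roles of the two equilibria.\<close>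
  using nash_equilibrium_exchange[OF assms(1,3,2)] nash_equilibrium_exchange[OF assms] ..

end
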